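(* Let $\alpha\in\mathbb{R}$. (i) Every best lower approximation of the third kind to $\alpha$ is an even-order convergent of $\alpha$. (ii) Every best upper approximation of the third kind to $\alpha$ is either $\frac{\lceil\alpha\rceil}{1}$ or an odd-order convergent of $\alpha$.
   Context: For $p\in\mathbb{Z}$, $q\in\mathbb{N}$, the fraction $\frac{p}{q}$ is a best lower approximation of the third kind to $\alpha$ if $0\le q^{2}(\alpha-\frac{p}{q})<(q')^{2}(\alpha-\frac{p'}{q'})$ for all $p'\in\mathbb{Z}$, $q'\in\mathbb{N}$ with $\frac{p'}{q'}\le\alpha$, $\frac{p'}{q'}\ne\frac{p}{q}$ and $q'\le q$; it is a best upper approximation of the third kind if $0\le q^{2}(\frac{p}{q}-\alpha)<(q')^{2}(\frac{p'}{q'}-\alpha)$ for all $p'\in\mathbb{Z}$, $q'\in\mathbb{N}$ with $\frac{p'}{q'}\ge\alpha$, $\frac{p'}{q'}\ne\frac{p}{q}$ and $q'\le q$. For $\alpha=[a_0;a_1,a_2,\ldots]$ (regular continued fraction, $a_0\in\mathbb{Z}$, $a_j\in\mathbb{N}$ for $j\ge1$, finite iff $\alpha\in\mathbb{Q}$ with last term $\ne1$ when there is more than one term), the $n$-th convergent is $\frac{p_n}{q_n}=[a_0;a_1,\ldots,a_n]$ where $p_{-1}=1,q_{-1}=0,p_0=a_0,q_0=1$, $p_n=a_np_{n-1}+p_{n-2}$, $q_n=a_nq_{n-1}+q_{n-2}$; it is even-order or odd-order according to the parity of $n$.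
   Formalization: If p/q = α (α rational), p/q is only claimed to be a convergent of some parity (or ⌈α⌉/1 in (ii)); the claim fails there, e.g. 1/2=[0;2] is its own best lower approximation but has odd order, and 2/3=[0;1,2] is its own best upper approximation but has even order. *)

theory Defs
  imports "HOL-Analysis.Analysis"
begin

section \<open>Regular continued fractions of real numbers\<close>

text \<open>
  The complete quotients \<open>x\<^sub>0 = \<alpha>\<close>, \<open>x\<^sub>n\<^sub>+\<^sub>1 = 1 / (x\<^sub>n - \<lfloor>x\<^sub>n\<rfloor>)\<close> of \<open>\<alpha>\<close>. The expansion stops at the
  first integral \<open>x\<^sub>n\<close>; later values are meaningless (\<open>1 / 0 = 0\<close>) and are excluded by
  \<open>cf_index\<close>, which says that the partial quotient \<open>a\<^sub>n\<close> exists.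
\<close>

fun cf_rem :: "real \<Rightarrow> nat \<Rightarrow> real" where
  "cf_rem \<alpha> 0 = \<alpha>"
| "cf_rem \<alpha> (Suc n) = 1 / frac (cf_rem \<alpha> n)"

definition cf_term :: "real \<Rightarrow> nat \<Rightarrow> int" where
  "cf_term \<alpha> n = \<lfloor>cf_rem \<alpha> n\<rfloor>"

definition cf_index :: "real \<Rightarrow> nat \<Rightarrow> bool" where
  "cf_index \<alpha> n \<longleftrightarrow> (\<forall>k<n. cf_rem \<alpha> k \<notin> \<int>)"

text \<open>
  Numerators \<open>p\<^sub>n\<close> and denominators \<open>q\<^sub>n\<close>; the equations for index \<open>1\<close> are the general recurrence
  evaluated with \<open>p\<^sub>-\<^sub>1 = 1\<close> and \<open>q\<^sub>-\<^sub>1 = 0\<close>.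
\<close>

fun cf_num :: "real \<Rightarrow> nat \<Rightarrow> int" where
  "cf_num \<alpha> 0 = cf_term \<alpha> 0"
| "cf_num \<alpha> (Suc 0) = cf_term \<alpha> 1 * cf_term \<alpha> 0 + 1"
| "cf_num \<alpha> (Suc (Suc n)) = cf_term \<alpha> (Suc (Suc n)) * cf_num \<alpha> (Suc n) + cf_num \<alpha> n"

fun cf_den :: "real \<Rightarrow> nat \<Rightarrow> int" where
  "cf_den \<alpha> 0 = 1"
| "cf_den \<alpha> (Suc 0) = cf_term \<alpha> 1"
| "cf_den \<alpha> (Suc (Suc n)) = cf_term \<alpha> (Suc (Suc n)) * cf_den \<alpha> (Suc n) + cf_den \<alpha> n"

definition is_convergent :: "real \<Rightarrow> nat \<Rightarrow> real \<Rightarrow> bool" where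
  "is_convergent \<alpha> n x \<longleftrightarrow> cf_index \<alpha> n \<and> x = of_int (cf_num \<alpha> n) / of_int (cf_den \<alpha> n)"


section \<open>Best one-sided approximations of the third kind\<close>

text \<open>
  The fraction is given by numerator and denominator; it need not be in lowest terms.
\<close>

definition best_lower_approx3 :: "real \<Rightarrow> int \<Rightarrow> nat \<Rightarrow> bool" where
  "best_lower_approx3 \<alpha> p q \<longleftrightarrow> q > 0 \<and>
     0 \<le> (real q)\<^sup>2 * (\<alpha> - of_int p / real q) \<and>
     (\<forall>(p'::int) (q'::nat). q' > 0 \<and> of_int p' / real q' \<le> \<alpha> \<and>
        of_int p' / real q' \<noteq> of_int p / real q \<and> q' \<le> q \<longrightarrow>
        (real q)\<^sup>2 * (\<alpha> - of_int p / real q) < (real q')\<^sup>2 * (\<alpha> - of_int p' / real q'))"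

definition best_upper_approx3 :: "real \<Rightarrow> int \<Rightarrow> nat \<Rightarrow> bool" where
  "best_upper_approx3 \<alpha> p q \<longleftrightarrow> q > 0 \<and>
     0 \<le> (real q)\<^sup>2 * (of_int p / real q - \<alpha>) \<and>
     (\<forall>(p'::int) (q'::nat). q' > 0 \<and> of_int p' / real q' \<ge> \<alpha> \<and>
        of_int p' / real q' \<noteq> of_int p / real q \<and> q' \<le> q \<longrightarrow>
        (real q)\<^sup>2 * (of_int p / real q - \<alpha>) < (real q')\<^sup>2 * (of_int p' / real q' - \<alpha>))"


section \<open>The expansion is the regular continued fraction of the number\<close>

lemma cf_index_Suc: "cf_index \<alpha> (Suc n) \<longleftrightarrow> cf_index \<alpha> n \<and> cf_rem \<alpha> n \<notin> \<int>"
  by (auto simp: cf_index_def less_Suc_eq)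

lemma cf_rem_gt_1:
  assumes "cf_index \<alpha> (Suc n)"
  shows "cf_rem \<alpha> (Suc n) > 1"
proof -
  have "frac (cf_rem \<alpha> n) > 0" "frac (cf_rem \<alpha> n) < 1"
    using assms by (auto simp: cf_index_Suc frac_gt_0_iff frac_lt_1)
  then show ?thesis by simp
qed

lemma cf_rem_step:
  assumes "cf_index \<alpha> (Suc n)"
  shows "cf_rem \<alpha> n * cf_rem \<alpha> (Suc n) = cf_term \<alpha> n * cf_rem \<alpha> (Suc n) + 1"
proof -
  have "frac (cf_rem \<alpha> n) > 0"
    using assms by (auto simp: cf_index_Suc frac_gt_0_iff)
  then show ?thesis
    by (auto simp: cf_term_def frac_def divide_simps)
qed

lemma cf_term_pos:
  assumes "cf_index \<alpha> n" "n > 0"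
  shows "cf_term \<alpha> n \<ge> 1"
proof -
  obtain m where "n = Suc m" using assms(2) gr0_conv_Suc by blast
  then show ?thesis
    using cf_rem_gt_1[of \<alpha> m] assms(1) by (simp add: cf_term_def del: cf_rem.simps)
qed

lemma cf_last_term_neq_1:
  assumes "cf_index \<alpha> n" "n > 0" "\<not> cf_index \<alpha> (Suc n)"
  shows "cf_term \<alpha> n \<noteq> 1"
proof -
  obtain m where m: "n = Suc m" using assms(2) gr0_conv_Suc by blast
  have "cf_rem \<alpha> n \<in> \<int>" using assms by (simp add: cf_index_Suc)
  moreover have "cf_rem \<alpha> n > 1" using cf_rem_gt_1[of \<alpha> m] assms(1) m by simp
  ultimately show ?thesis by (auto simp: cf_term_def Ints_def)
qed

lemma cf_den_ge: "cf_index \<alpha> n \<Longrightarrow> cf_den \<alpha> n \<ge> 1 \<and> cf_den \<alpha> n \<ge> int n"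
proof (induction \<alpha> n rule: cf_den.induct)
  case (1 \<alpha>)
  then show ?case by simp
next
  case (2 \<alpha>)
  then show ?case using cf_term_pos[of \<alpha> 1] by simp
next
  case (3 \<alpha> n)
  have "cf_den \<alpha> (Suc n) \<ge> 1" "cf_den \<alpha> (Suc n) \<ge> int (Suc n)" "cf_den \<alpha> n \<ge> 1"
    using 3 by (auto simp: cf_index_Suc)
  moreover have "cf_term \<alpha> (Suc (Suc n)) \<ge> 1"
    using cf_term_pos 3 by blast
  ultimately have "cf_term \<alpha> (Suc (Suc n)) * cf_den \<alpha> (Suc n) \<ge> 1 * cf_den \<alpha> (Suc n)"
    by (intro mult_right_mono) auto
  then show ?case
    using \<open>cf_den \<alpha> (Suc n) \<ge> int (Suc n)\<close> \<open>cf_den \<alpha> n \<ge> 1\<close>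
    by (simp only: cf_den.simps) linarith
qed

lemma cf_det: "cf_num \<alpha> (Suc n) * cf_den \<alpha> n - cf_num \<alpha> n * cf_den \<alpha> (Suc n) = (-1) ^ n"
  by (induction n) (auto simp: algebra_simps)

lemma cf_complete_quotient:
  fixes \<alpha> :: real
  assumes "cf_index \<alpha> (Suc (Suc n))"
  shows "\<alpha> * (cf_rem \<alpha> (Suc (Suc n)) * cf_den \<alpha> (Suc n) + cf_den \<alpha> n)
         = cf_rem \<alpha> (Suc (Suc n)) * cf_num \<alpha> (Suc n) + cf_num \<alpha> n"
  using assms
proof (induction n)
  case 0
  define x1 x2 where "x1 = cf_rem \<alpha> (Suc 0)" "x2 = cf_rem \<alpha> (Suc (Suc 0))"
  have "\<alpha> * x1 = cf_term \<alpha> 0 * x1 + 1" "x1 * x2 = cf_term \<alpha> 1 * x2 + 1"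
    using cf_rem_step[of \<alpha> 0] cf_rem_step[of \<alpha> 1] 0
    by (simp_all add: cf_index_Suc x1_x2_def)
  moreover have "x1 > 0" using cf_rem_gt_1[of \<alpha> 0] 0 by (simp add: cf_index_Suc x1_x2_def)
  moreover have "\<alpha> * (x1 * x2) = cf_term \<alpha> 0 * (x1 * x2) + x2"
    using calculation(1) by algebra
  ultimately show ?case
    unfolding x1_x2_def[symmetric] by (simp add: algebra_simps)
next
  case (Suc n)
  define x y where "x = cf_rem \<alpha> (Suc (Suc n))" "y = cf_rem \<alpha> (Suc (Suc (Suc n)))"
  define P Q R S where PQ: "P = real_of_int (cf_num \<alpha> (Suc n))" "Q = real_of_int (cf_den \<alpha> (Suc n))"
    "R = real_of_int (cf_num \<alpha> n)" "S = real_of_int (cf_den \<alpha> n)"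
  define a where "a = real_of_int (cf_term \<alpha> (Suc (Suc n)))"
  have 1: "\<alpha> * (x * Q + S) = x * P + R"
    using Suc by (simp add: cf_index_Suc x_y_def PQ)
  have 2: "x * y = a * y + 1"
    using cf_rem_step[OF Suc.prems] by (simp add: x_y_def a_def)
  have "\<alpha> * (y * (a * Q + S) + Q) = y * (a * P + R) + P"
    using 1 2 by algebra
  then show ?case
    by (simp add: x_y_def a_def PQ del: cf_rem.simps)
qed

lemma cf_finite_value:
  fixes \<alpha> :: real
  assumes "cf_index \<alpha> n" "\<not> cf_index \<alpha> (Suc n)"
  shows "is_convergent \<alpha> n \<alpha>"
proof -
  have int: "cf_rem \<alpha> n = cf_term \<alpha> n"
    using assms by (auto simp: cf_index_Suc cf_term_def Ints_def)
  have den: "real_of_int (cf_den \<alpha> n) > 0" using cf_den_ge[OF assms(1)] by simp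
  have "\<alpha> * cf_den \<alpha> n = cf_num \<alpha> n"
  proof (cases "(\<alpha>, n)" rule: cf_den.cases)
    case (3 \<beta> m)
    then show ?thesis
      using cf_complete_quotient[of \<alpha> m] assms(1) int by (simp del: cf_rem.simps)
  next
    case (2 \<beta>)
    then show ?thesis
      using cf_rem_step[of \<alpha> 0] assms(1) int by (simp add: mult.commute del: cf_rem.simps(2))
  next
    case (1 \<beta>)
    then show ?thesis using int by simp
  qed
  then show ?thesis using assms(1) den by (simp add: is_convergent_def field_simps)
qed

lemma cf_error_bound:
  fixes \<alpha> :: real
  assumes "cf_index \<alpha> (Suc (Suc n))"
  shows "0 < \<bar>\<alpha> * cf_den \<alpha> (Suc n) - cf_num \<alpha> (Suc n)\<bar>"
    and "\<bar>\<alpha> * cf_den \<alpha> (Suc n) - cf_num \<alpha> (Suc n)\<bar> \<le> 1 / cf_den \<alpha> (Suc n)"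
proof -
  define x where "x = cf_rem \<alpha> (Suc (Suc n))"
  define P Q R S where PQ: "P = real_of_int (cf_num \<alpha> (Suc n))" "Q = real_of_int (cf_den \<alpha> (Suc n))"
    "R = real_of_int (cf_num \<alpha> n)" "S = real_of_int (cf_den \<alpha> n)"
  have x: "x > 1" using cf_rem_gt_1 assms x_def by blast
  have QS: "Q \<ge> 1" "S \<ge> 1"
    using cf_den_ge[of \<alpha> n] cf_den_ge[of \<alpha> "Suc n"] assms by (auto simp: PQ cf_index_Suc)
  define e :: real where "e = (-1) ^ n"
  have det: "P * S - R * Q = e"
    using arg_cong[OF cf_det[of \<alpha> n], of real_of_int] by (simp add: PQ e_def)
  have "\<alpha> * (x * Q + S) = x * P + R"
    using cf_complete_quotient[OF assms] by (simp add: PQ x_def)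
  then have "Q * (\<alpha> * (x * Q + S)) = Q * (x * P + R)"
    by simp
  then have "(\<alpha> * Q - P) * (x * Q + S) = - e"
    unfolding det[symmetric] by (simp add: algebra_simps)
  then have "\<bar>\<alpha> * Q - P\<bar> * \<bar>x * Q + S\<bar> = 1"
    unfolding abs_mult[symmetric] by (simp add: e_def)
  moreover have "x * Q \<ge> 1 * Q" using x QS by (intro mult_right_mono) linarith+
  then have *: "x * Q + S \<ge> Q" "x * Q + S > 0" using QS by linarith+
  ultimately have eq: "\<bar>\<alpha> * Q - P\<bar> = 1 / (x * Q + S)" by (simp add: field_simps)
  show "0 < \<bar>\<alpha> * cf_den \<alpha> (Suc n) - cf_num \<alpha> (Suc n)\<bar>"
    using eq * unfolding PQ(1,2)[symmetric] by simp
  show "\<bar>\<alpha> * cf_den \<alpha> (Suc n) - cf_num \<alpha> (Suc n)\<bar> \<le> 1 / cf_den \<alpha> (Suc n)"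
    using eq * QS unfolding PQ(1,2)[symmetric] by (simp add: frac_le)
qed

lemma cf_infinite_limit:
  fixes \<alpha> :: real
  assumes "\<And>n. cf_index \<alpha> n"
  shows "(\<lambda>n. of_int (cf_num \<alpha> n) / of_int (cf_den \<alpha> n)) \<longlonglongrightarrow> \<alpha>"
proof -
  have "\<bar>cf_num \<alpha> (Suc n) / cf_den \<alpha> (Suc n) - \<alpha>\<bar> \<le> 1 / real (Suc n)" for n
  proof -
    define P Q where PQ: "P = real_of_int (cf_num \<alpha> (Suc n))" "Q = real_of_int (cf_den \<alpha> (Suc n))"
    have Q: "Q \<ge> 1" "Q \<ge> real (Suc n)"
      using cf_den_ge[OF assms, of "Suc n"] unfolding PQ by linarith+
    have "\<bar>P / Q - \<alpha>\<bar> = \<bar>\<alpha> * Q - P\<bar> / Q"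
      using Q by (simp add: abs_if field_simps)
    also have "\<dots> \<le> (1 / Q) / 1"
      using cf_error_bound(2)[OF assms, of n] Q unfolding PQ by (intro frac_le) auto
    also have "\<dots> \<le> 1 / real (Suc n)" using Q by (simp add: frac_le del: of_nat_Suc)
    finally show ?thesis unfolding PQ .
  qed
  then have "(\<lambda>n. cf_num \<alpha> (Suc n) / cf_den \<alpha> (Suc n) - \<alpha>) \<longlonglongrightarrow> 0"
    by (intro Lim_null_comparison[OF _ lim_1_over_n[THEN LIMSEQ_Suc]]) (auto intro!: always_eventually)
  then show ?thesis
    by (simp add: LIM_zero_iff filterlim_sequentially_Suc[of "\<lambda>n. cf_num \<alpha> n / cf_den \<alpha> n"])
qed

lemma cf_finite_iff_rational: "(\<exists>n. \<not> cf_index \<alpha> n) \<longleftrightarrow> \<alpha> \<in> \<rat>"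
proof
  assume "\<exists>n. \<not> cf_index \<alpha> n"
  then have "\<exists>m. cf_index \<alpha> m \<and> \<not> cf_index \<alpha> (Suc m)"
    by (metis cf_index_def not_less_zero nat_induct)
  then show "\<alpha> \<in> \<rat>"
    using cf_finite_value unfolding is_convergent_def by (metis Rats_divide Rats_of_int)
next
  assume "\<alpha> \<in> \<rat>"
  then obtain a b :: int where b: "b > 0" "\<alpha> = of_int a / of_int b"
    by (metis Rats_cases')
  show "\<exists>n. \<not> cf_index \<alpha> n"
  proof (rule ccontr)
    assume "\<not> ?thesis"
    then have all: "cf_index \<alpha> n" for n by blast
    define n where "n = nat b"
    define z where "z = a * cf_den \<alpha> (Suc n) - b * cf_num \<alpha> (Suc n)"
    have Q: "cf_den \<alpha> (Suc n) > b" using cf_den_ge[OF all, of "Suc n"] b by (simp add: n_def)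
    have e: "\<alpha> * cf_den \<alpha> (Suc n) - cf_num \<alpha> (Suc n) = z / b"
      using b by (simp add: z_def field_simps)
    have "z \<noteq> 0" using cf_error_bound(1)[OF all, of n] e by auto
    then have "1 / real_of_int b \<le> \<bar>z / b\<bar>"
      using b by (simp add: divide_simps)
    also have "\<dots> \<le> 1 / cf_den \<alpha> (Suc n)"
      using cf_error_bound(2)[OF all, of n] e by simp
    finally show False using Q b by (simp add: divide_simps split: if_splits)
  qed
qed

end

theory Submission
  imports Defs
begin

text \<open>
  Suppose \<open>p/q\<close> lies strictly between \<open>p\<^sub>n/q\<^sub>n\<close> and \<open>\<alpha>\<close>, and strictly before \<open>p\<^sub>n\<^sub>+\<^sub>2/q\<^sub>n\<^sub>+\<^sub>2\<close> if that
  convergent exists. As consecutive convergents form a basis of the integer lattice,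
  \<open>(p, q) = s (p\<^sub>n, q\<^sub>n) + t (p\<^sub>n\<^sub>+\<^sub>1, q\<^sub>n\<^sub>+\<^sub>1)\<close> with positive integers \<open>s, t\<close>. With
  \<open>D = \<bar>q\<^sub>n \<alpha> - p\<^sub>n\<bar>\<close> and \<open>w = \<bar>q\<^sub>n\<^sub>+\<^sub>1 \<alpha> - p\<^sub>n\<^sub>+\<^sub>1\<bar>\<close> one has \<open>\<bar>q \<alpha> - p\<bar> = s D - t w \<ge> w\<close>, and
  this forces \<open>q \<bar>q \<alpha> - p\<bar> \<ge> q\<^sub>n D\<close>. Hence \<open>p\<^sub>n/q\<^sub>n\<close> beats \<open>p/q\<close> as an approximation of the third
  kind. For upper approximations between \<open>p\<^sub>1/q\<^sub>1\<close> and \<open>\<lceil>\<alpha>\<rceil>\<close> the same argument applies to the basis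
  \<open>(a\<^sub>0 + 1, 1), (a\<^sub>0, 1)\<close>.
\<close>

section \<open>Lattice combinations; denominators and errors of convergents\<close>

lemma lattice_combination_bound:
  fixes s t Q Q' D w :: real
  assumes "1 \<le> s" "0 \<le> t" "0 \<le> Q" "Q \<le> Q'" "0 \<le> w" "w \<le> s * D - t * w"
  shows "Q * D \<le> (s * Q + t * Q') * (s * D - t * w)"
proof -
  define r where "r = s * D - t * w"
  have r: "0 \<le> w" "w \<le> r" using assms by (auto simp: r_def)
  have "1 * r \<le> (s * s) * r"
    using assms r by (intro mult_right_mono) (auto intro: order_trans[OF _ mult_mono[of 1 s 1 s]])
  moreover have "t * w \<le> s * (t * r)"
  proof -
    have "t * w \<le> t * r" using assms r by (intro mult_left_mono) auto
    also have "\<dots> \<le> s * (t * r)"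
      using assms r mult_right_mono[of 1 s "t * r"] by simp
    finally show ?thesis .
  qed
  \<comment> \<open>Here \<open>s * D = r + t * w\<close>. The two bounds replace \<open>r\<close>
    by \<open>s * s * r\<close> and \<open>t * w\<close> by \<open>s * (t * r)\<close>, so that a
    factor \<open>s\<close> can be cancelled.\<close>
  ultimately have "s * D \<le> s * ((s + t) * r)"
    by (simp add: r_def algebra_simps)
  then have "D \<le> (s + t) * r" using assms by simp
  then have "Q * D \<le> Q * ((s + t) * r)" using assms by (intro mult_left_mono)
  also have "\<dots> = (s * Q + t * Q) * r" by (simp add: algebra_simps)
  also have "\<dots> \<le> (s * Q + t * Q') * r"
    using assms r by (intro mult_right_mono add_left_mono mult_left_mono) auto
  finally show ?thesis by (simp add: r_def)
qed

lemma cf_den_mono: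
  assumes "cf_index \<alpha> (Suc n)"
  shows "cf_den \<alpha> n \<le> cf_den \<alpha> (Suc n)"
proof (cases n)
  case 0
  then show ?thesis using cf_term_pos[OF assms] by simp
next
  case (Suc m)
  have "1 * cf_den \<alpha> (Suc m) \<le> cf_term \<alpha> (Suc (Suc m)) * cf_den \<alpha> (Suc m)"
    using cf_term_pos[OF assms] cf_den_ge[of \<alpha> "Suc m"] assms Suc
    by (intro mult_right_mono) (auto simp: cf_index_Suc)
  moreover have "0 \<le> cf_den \<alpha> m"
    using cf_den_ge[of \<alpha> m] assms Suc by (auto simp: cf_index_Suc)
  ultimately show ?thesis using Suc by simp
qed

text \<open>By the complete quotient formula the signed errors satisfy
  \<open>\<delta> n = x * \<delta> (Suc n)\<close>. With the recurrence this gives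
  \<open>\<delta> (Suc (Suc n)) = (x - a) * \<delta> (Suc n)\<close>, and \<open>a\<close> is the
  floor of \<open>x\<close>. The error of the last convergent of a rational number is 0, so the
  inequality is weak.\<close>

lemma cf_error_sign:
  assumes "cf_index \<alpha> n"
  shows "0 \<le> (-1) ^ n * (\<alpha> * cf_den \<alpha> n - cf_num \<alpha> n)"
  using assms
proof (induction \<alpha> n rule: cf_den.induct)
  case (1 \<alpha>)
  then show ?case by (simp add: cf_term_def)
next
  case (2 \<alpha>)
  define x where "x = cf_rem \<alpha> 1"
  have "\<alpha> * x = cf_term \<alpha> 0 * x + 1"
    using cf_rem_step[of \<alpha> 0] 2 by (simp add: x_def)
  then have x: "(\<alpha> - cf_term \<alpha> 0) * x = 1" by (simp add: algebra_simps)
  have "(\<alpha> - cf_term \<alpha> 0) * cf_term \<alpha> 1 \<le> (\<alpha> - cf_term \<alpha> 0) * x"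
    by (intro mult_left_mono) (auto simp: cf_term_def x_def)
  then show ?case using x by (simp add: algebra_simps)
next
  case (3 \<alpha> n)
  define x a where "x = cf_rem \<alpha> (Suc (Suc n))" "a = real_of_int (cf_term \<alpha> (Suc (Suc n)))"
  define \<delta> where "\<delta> k = (-1) ^ k * (\<alpha> * cf_den \<alpha> k - cf_num \<alpha> k)" for k
  define e :: real where "e = (-1) ^ n"
  have "\<delta> n = x * \<delta> (Suc n)"
    using cf_complete_quotient[OF 3(3)]
    by (simp add: \<delta>_def x_a_def e_def[symmetric] del: cf_rem.simps) algebra
  moreover have "\<delta> (Suc (Suc n)) = \<delta> n - a * \<delta> (Suc n)"
    by (simp add: \<delta>_def x_a_def algebra_simps)
  ultimately have "\<delta> (Suc (Suc n)) = (x - a) * \<delta> (Suc n)" by (simp add: algebra_simps)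
  moreover have "a \<le> x" by (simp add: x_a_def cf_term_def)
  moreover have "0 \<le> \<delta> (Suc n)" using 3 by (simp add: \<delta>_def cf_index_Suc)
  ultimately have "0 \<le> \<delta> (Suc (Suc n))" by simp
  then show ?case unfolding \<delta>_def .
qed

section \<open>Fractions compared with convergents of one parity\<close>

text \<open>The factor \<open>(-1) ^ n\<close> treats lower approximations (\<open>n\<close> even)
  and upper ones (\<open>n\<close> odd) at once; the position of p/q is expressed without
  denominators. The two conclusions together prevent p/q from being best.\<close>

lemma convergent_beats_intermediate:
  fixes \<alpha> :: real and p q :: int
  assumes idx: "cf_index \<alpha> (Suc n)" and q: "0 < q"
    and side: "0 < (-1) ^ n * (\<alpha> * q - p)"
    and after: "0 < (-1) ^ n * (p * cf_den \<alpha> n - cf_num \<alpha> n * q)"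
    and before: "cf_index \<alpha> (Suc (Suc n)) \<Longrightarrow>
      0 < (-1) ^ n * (cf_num \<alpha> (Suc (Suc n)) * q - p * cf_den \<alpha> (Suc (Suc n)))"
  shows "cf_den \<alpha> n \<le> q"
    and "cf_den \<alpha> n * ((-1) ^ n * (\<alpha> * cf_den \<alpha> n - cf_num \<alpha> n)) \<le> q * ((-1) ^ n * (\<alpha> * q - p))"
proof -
  define e :: int where "e = (-1) ^ n"
  define P Q P' Q' where PQ: "P = cf_num \<alpha> n" "Q = cf_den \<alpha> n"
    "P' = cf_num \<alpha> (Suc n)" "Q' = cf_den \<alpha> (Suc n)"
  \<comment> \<open>Cramer's rule for \<open>(p, q)\<close> in the basis \<open>(P, Q)\<close>,
    \<open>(P', Q')\<close>. The determinant \<open>e\<close> is its own inverse, so the coordinates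
    are integers.\<close>
  define s t where st: "s = e * (P' * q - Q' * p)" "t = e * (p * Q - P * q)"
  \<comment> \<open>The errors of consecutive convergents have opposite signs, hence the minus in
    \<open>w\<close>.\<close>
  define D w where Dw: "D = e * (\<alpha> * Q - P)" "w = - e * (\<alpha> * Q' - P')"
  have e_real: "real_of_int e = (-1) ^ n" by (simp add: e_def)
  have ee: "e * e = 1" by (simp add: e_def flip: power_mult_distrib)
  have det: "P' * Q - P * Q' = e" using cf_det[of \<alpha> n] by (simp add: PQ e_def)
  have "s * Q + t * Q' = q * (e * (P' * Q - P * Q'))" "s * P + t * P' = p * (e * (P' * Q - P * Q'))"
    by (simp_all add: st algebra_simps)
  then have comb: "s * Q + t * Q' = q" "s * P + t * P' = p"
    by (simp_all add: det ee)
  have Q: "1 \<le> Q" "Q \<le> Q'"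
    using cf_den_ge[of \<alpha> n] cf_den_mono[OF idx] idx by (auto simp: PQ cf_index_Suc)
  have w: "0 \<le> w" using cf_error_sign[OF idx] by (simp add: Dw PQ e_real)
  have D: "0 \<le> D" using cf_error_sign[of \<alpha> n] idx by (simp add: Dw PQ e_real cf_index_Suc)
  have t: "0 < t" using after by (simp add: st PQ e_def)
  have err: "e * (\<alpha> * q - p) = s * D - t * w"
    unfolding comb[symmetric] Dw by (simp add: algebra_simps)
  have side': "0 < e * (\<alpha> * q - p)" using side by (simp add: e_real)
  \<comment> \<open>The terms with \<alpha> cancel. The second summand is strictly positive, so
    \<open>s\<close> is positive even when \<open>w = 0\<close>.\<close>
  have "real_of_int s = q * w + Q' * (e * (\<alpha> * q - p))"
    by (simp add: st Dw algebra_simps)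
  moreover have "0 < Q' * (e * (\<alpha> * q - p))" using side' Q by (intro mult_pos_pos[OF _ side']) auto
  moreover have "0 \<le> q * w" using w q by simp
  ultimately have "0 < real_of_int s" by linarith
  then have s: "1 \<le> s" by simp
  \<comment> \<open>If the expansion ends at \<open>Suc n\<close>, then \<open>w = 0\<close>.
    Otherwise \<open>before\<close> reads \<open>t < a * s\<close> by the recurrence; integrality
    improves this to \<open>t + 1 \<le> a * s\<close>, which supplies the extra \<open>w\<close>,
    and \<open>D - a * w\<close> is the nonnegative error of the next convergent of the same
    parity.\<close>
  have "w \<le> s * D - t * w"
  proof (cases "cf_index \<alpha> (Suc (Suc n))")
    case False
    have "\<alpha> = P' / Q'"
      using cf_finite_value[OF idx False] by (simp add: is_convergent_def PQ)
    then have "w = 0" using Q by (simp add: Dw)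
    then show ?thesis using s D by simp
  next
    case True
    define a where "a = cf_term \<alpha> (Suc (Suc n))"
    have "0 < a * s - t"
      using before[OF True] by (simp add: st a_def PQ e_def algebra_simps)
    then have "t + 1 \<le> a * s" by simp
    then have "real_of_int (t + 1) \<le> real_of_int (a * s)" by (simp only: of_int_le_iff)
    then have "real_of_int (t + 1) * w \<le> real_of_int (a * s) * w"
      using w by (intro mult_right_mono)
    moreover have "a * w \<le> D"
      using cf_error_sign[OF True] by (simp add: Dw PQ a_def e_real algebra_simps)
    then have "s * (a * w) \<le> s * D" using s by (intro mult_left_mono) auto
    ultimately show ?thesis by (simp add: algebra_simps)
  qed
  then have "Q * D \<le> (real_of_int s * real_of_int Q + real_of_int t * real_of_int Q') * (s * D - t * w)"
    using s t Q w by (intro lattice_combination_bound) auto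
  also have "real_of_int s * real_of_int Q + real_of_int t * real_of_int Q' = q"
    using arg_cong[OF comb(1), of real_of_int] by simp
  finally show "cf_den \<alpha> n * ((-1) ^ n * (\<alpha> * cf_den \<alpha> n - cf_num \<alpha> n)) \<le> q * ((-1) ^ n * (\<alpha> * q - p))"
    unfolding err[symmetric] by (simp add: Dw PQ e_real)
  have "1 * Q \<le> s * Q" using s Q by (intro mult_right_mono) auto
  moreover have "0 \<le> t * Q'" using t Q by simp
  ultimately show "cf_den \<alpha> n \<le> q" using comb(1) unfolding PQ(2) by linarith
qed

text \<open>Follow the convergents of indices m, m + 2, ... towards \<alpha> and stop at the last
  one that does not pass p/q. Either it equals p/q, or p/q lies strictly between it and its
  successor, if there is one, and the preceding comparison applies.\<close>

lemma convergent_or_beaten: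
  fixes \<alpha> :: real and p q :: int
  assumes idx: "cf_index \<alpha> m" and q: "0 < q"
    and side: "0 < (-1) ^ m * (\<alpha> * q - p)"
    and after: "0 \<le> (-1) ^ m * (p * cf_den \<alpha> m - cf_num \<alpha> m * q)"
  obtains n where "even n = even m" "cf_index \<alpha> n" "p * cf_den \<alpha> n = cf_num \<alpha> n * q"
  | n where "even n = even m" "cf_index \<alpha> n" "p * cf_den \<alpha> n \<noteq> cf_num \<alpha> n * q" "cf_den \<alpha> n \<le> q"
    "cf_den \<alpha> n * ((-1) ^ n * (\<alpha> * cf_den \<alpha> n - cf_num \<alpha> n)) \<le> q * ((-1) ^ n * (\<alpha> * q - p))"
proof -
  define B where "B k \<longleftrightarrow> cf_index \<alpha> (m + 2 * k) \<and>
    0 \<le> (-1) ^ m * (p * cf_den \<alpha> (m + 2 * k) - cf_num \<alpha> (m + 2 * k) * q)" for k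
  \<comment> \<open>If \<open>B\<close> never failed, the expansion would be infinite, and letting
    the convergents tend to \<alpha> would put p/q at \<alpha> or beyond it, against
    \<open>side\<close>.\<close>
  have "\<exists>k. B k \<and> \<not> B (Suc k)"
  proof (rule ccontr)
    assume "\<not> ?thesis"
    moreover have "B 0" using idx after by (simp add: B_def)
    ultimately have B: "B k" for k by (induction k) auto
    have all: "cf_index \<alpha> k" for k
      using B[of k] by (auto simp: B_def cf_index_def)
    have "strict_mono (\<lambda>k. m + 2 * k)" by (simp add: strict_mono_def)
    from LIMSEQ_subseq_LIMSEQ[OF cf_infinite_limit[OF all] this]
    have lim: "(\<lambda>k. (-1) ^ m * (p - q * (cf_num \<alpha> (m + 2 * k) / cf_den \<alpha> (m + 2 * k))))
        \<longlonglongrightarrow> (-1) ^ m * (p - q * \<alpha>)"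
      by (intro tendsto_intros) (simp add: o_def)
    have nonneg: "0 \<le> (-1) ^ m * (p - q * (cf_num \<alpha> (m + 2 * k) / cf_den \<alpha> (m + 2 * k)))" for k
    proof -
      define e :: int where "e = (-1) ^ m"
      define P Q where PQ: "P = cf_num \<alpha> (m + 2 * k)" "Q = cf_den \<alpha> (m + 2 * k)"
      have Q: "1 \<le> Q" using cf_den_ge[OF all] by (simp add: PQ)
      have "0 \<le> e * (p * Q - P * q)" using B[of k] by (simp add: B_def PQ e_def)
      then have "0 \<le> real_of_int (e * (p * Q - P * q)) / Q" using Q by (simp only: of_int_0_le_iff divide_nonneg_pos)
      also have "\<dots> = e * (p - q * (P / Q))" using Q by (simp add: field_simps)
      finally show ?thesis by (simp add: PQ e_def)
    qed
    have "0 \<le> (-1) ^ m * (p - q * \<alpha>)"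
      by (rule LIMSEQ_le_const[OF lim]) (intro exI allI impI nonneg)
    then show False using side by (simp add: algebra_simps)
  qed
  then obtain k where k: "B k" "\<not> B (Suc k)" by blast
  define n where "n = m + 2 * k"
  have par: "even n = even m" and sgn: "(-1::int) ^ n = (-1) ^ m" "(-1::real) ^ n = (-1) ^ m"
    by (simp_all add: n_def power_add)
  have n: "cf_index \<alpha> n" "0 \<le> (-1) ^ n * (p * cf_den \<alpha> n - cf_num \<alpha> n * q)"
    using k(1) unfolding B_def n_def[symmetric] sgn by blast+
  show thesis
  proof (cases "p * cf_den \<alpha> n = cf_num \<alpha> n * q")
    case True
    then show thesis using that(1) par n by blast
  next
    case False
    then have pos: "0 < (-1) ^ n * (p * cf_den \<alpha> n - cf_num \<alpha> n * q)"
      using n(2) by (simp only: less_le) simp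
    have side': "0 < (-1) ^ n * (\<alpha> * q - p)" using side sgn by simp
    \<comment> \<open>If the expansion ended at \<open>n\<close>, convergent \<open>n\<close> would
      be \<alpha> itself, and \<open>pos\<close> and \<open>side'\<close> would place p/q on
      opposite sides of it.\<close>
    have idx_Suc: "cf_index \<alpha> (Suc n)"
    proof (rule ccontr)
      assume "\<not> ?thesis"
      then have \<alpha>: "\<alpha> * cf_den \<alpha> n = cf_num \<alpha> n"
        using cf_finite_value[OF n(1)] cf_den_ge[OF n(1)]
        by (simp add: is_convergent_def nonzero_eq_divide_eq)
      have "0 < cf_den \<alpha> n * ((-1) ^ n * (\<alpha> * q - p))"
        using cf_den_ge[OF n(1)] by (intro mult_pos_pos[OF _ side']) simp
      also have "\<dots> = (-1) ^ n * (q * (\<alpha> * cf_den \<alpha> n) - p * cf_den \<alpha> n)"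
        by (simp add: algebra_simps)
      also have "\<dots> = - real_of_int ((-1) ^ n * (p * cf_den \<alpha> n - cf_num \<alpha> n * q))"
        unfolding \<alpha> by (simp add: algebra_simps)
      finally have "real_of_int ((-1) ^ n * (p * cf_den \<alpha> n - cf_num \<alpha> n * q)) < 0"
        by (simp only: neg_0_less_iff_less)
      then show False using pos by (simp only: of_int_less_0_iff)
    qed
    \<comment> \<open>\<open>B (Suc k)\<close> may also fail because the expansion has ended, hence
      the condition.\<close>
    have before: "0 < (-1) ^ n * (cf_num \<alpha> (Suc (Suc n)) * q - p * cf_den \<alpha> (Suc (Suc n)))"
      if "cf_index \<alpha> (Suc (Suc n))"
    proof -
      have next_index: "Suc (Suc n) = m + 2 * Suc k" by (simp add: n_def)
      have "\<not> 0 \<le> (-1) ^ n * (p * cf_den \<alpha> (Suc (Suc n)) - cf_num \<alpha> (Suc (Suc n)) * q)"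
        using k(2) that unfolding B_def sgn next_index by blast
      then have "0 < - ((-1) ^ n * (p * cf_den \<alpha> (Suc (Suc n)) - cf_num \<alpha> (Suc (Suc n)) * q))"
        by (simp only: not_le neg_0_less_iff_less)
      then show ?thesis by (simp only: mult_minus_right[symmetric] minus_diff_eq)
    qed
    show thesis
      using that(2)[OF par n(1) False] convergent_beats_intermediate[OF idx_Suc q side' pos before]
      by simp
  qed
qed

text \<open>The expansion of a rational number stops, and its last convergent is the number. This
  settles error 0, where the strict inequality \<open>side\<close> fails; the parity of
  \<open>n\<close> is not controlled.\<close>

lemma value_is_convergent:
  fixes p q :: int
  assumes "\<alpha> = of_int p / of_int q"
  obtains n where "is_convergent \<alpha> n \<alpha>"
proof -
  have "\<alpha> \<in> \<rat>" using assms by simp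
  then have "\<exists>m. cf_index \<alpha> m \<and> \<not> cf_index \<alpha> (Suc m)"
    unfolding cf_finite_iff_rational[symmetric] by (metis cf_index_def not_less_zero nat_induct)
  then show thesis using cf_finite_value that by blast
qed

section \<open>One-sided best approximations\<close>

text \<open>Restates the definition with denominators cleared, the form in which the comparison with
  convergents is proved; \<open>q'\<close> is an integer because \<open>cf_den\<close> is.\<close>

lemma best_lower_approx3_beats:
  assumes "best_lower_approx3 \<alpha> p q" "0 < q'" "q' \<le> int q" "0 \<le> \<alpha> * q' - p'" "p * q' \<noteq> p' * int q"
  shows "q * (\<alpha> * q - p) < q' * (\<alpha> * q' - p')"
proof -
  obtain k where k: "q' = int k" using assms(2) zero_le_imp_eq_int[of q'] by auto
  have q: "q > 0" using assms(1) by (simp add: best_lower_approx3_def)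
  have "real_of_int (p * q') \<noteq> real_of_int (p' * int q)" unfolding of_int_eq_iff by (rule assms(5))
  then have "of_int p' / real k \<noteq> of_int p / real q"
    using assms(2) q k by (simp add: field_simps)
  moreover have "of_int p' / real k \<le> \<alpha>" using assms(2,4) k by (simp add: field_simps)
  ultimately have "(real q)\<^sup>2 * (\<alpha> - of_int p / real q) < (real k)\<^sup>2 * (\<alpha> - of_int p' / real k)"
    using assms(1-3) k by (simp add: best_lower_approx3_def)
  moreover have "(real q)\<^sup>2 * (\<alpha> - of_int p / real q) = q * (\<alpha> * q - p)"
    "(real k)\<^sup>2 * (\<alpha> - of_int p' / real k) = q' * (\<alpha> * q' - p')"
    using q k assms(2) by (simp_all add: power2_eq_square field_simps)
  ultimately show ?thesis by simp
qed

lemma best_upper_approx3_beats: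
  assumes "best_upper_approx3 \<alpha> p q" "0 < q'" "q' \<le> int q" "0 \<le> p' - \<alpha> * q'" "p * q' \<noteq> p' * int q"
  shows "q * (p - \<alpha> * q) < q' * (p' - \<alpha> * q')"
proof -
  obtain k where k: "q' = int k" using assms(2) zero_le_imp_eq_int[of q'] by auto
  have q: "q > 0" using assms(1) by (simp add: best_upper_approx3_def)
  have "real_of_int (p * q') \<noteq> real_of_int (p' * int q)" unfolding of_int_eq_iff by (rule assms(5))
  then have "of_int p' / real k \<noteq> of_int p / real q"
    using assms(2) q k by (simp add: field_simps)
  moreover have "\<alpha> \<le> of_int p' / real k" using assms(2,4) k by (simp add: field_simps)
  ultimately have "(real q)\<^sup>2 * (of_int p / real q - \<alpha>) < (real k)\<^sup>2 * (of_int p' / real k - \<alpha>)"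
    using assms(1-3) k by (simp add: best_upper_approx3_def)
  moreover have "(real q)\<^sup>2 * (of_int p / real q - \<alpha>) = q * (p - \<alpha> * q)"
    "(real k)\<^sup>2 * (of_int p' / real k - \<alpha>) = q' * (p' - \<alpha> * q')"
    using q k assms(2) by (simp_all add: power2_eq_square field_simps)
  ultimately show ?thesis by simp
qed

lemma convergentI_cross_mult:
  assumes "cf_index \<alpha> n" "p * cf_den \<alpha> n = cf_num \<alpha> n * int q" "q > 0"
  shows "is_convergent \<alpha> n (of_int p / real q)"
proof -
  have "real_of_int p * cf_den \<alpha> n = cf_num \<alpha> n * real q"
    using arg_cong[OF assms(2), of real_of_int] by simp
  then show ?thesis
    using assms cf_den_ge[OF assms(1)] by (simp add: is_convergent_def field_simps)
qed

text \<open>The search through the convergents starts at index 0. Being beaten by a convergent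
  contradicts \<open>best\<close>, so p/q is one of them.\<close>

lemma best_lower_approx3_even_convergent:
  assumes best: "best_lower_approx3 \<alpha> p q" and neq: "of_int p / real q \<noteq> \<alpha>"
  shows "\<exists>n. even n \<and> is_convergent \<alpha> n (of_int p / real q)"
proof -
  have q: "q > 0" using best by (simp add: best_lower_approx3_def)
  have "0 \<le> \<alpha> - of_int p / real q"
    using best q by (simp add: best_lower_approx3_def zero_le_mult_iff)
  with neq have "of_int p / real q < \<alpha>" by simp
  then have lt: "0 < \<alpha> * q - p" using q by (simp add: field_simps)
  \<comment> \<open>A fraction below the floor of \<alpha> loses to the floor over 1: its scaled
    error is at least \<open>\<alpha> * q - p\<close>, which exceeds \<open>q\<close> times the
    error of the floor.\<close>
  have after: "cf_num \<alpha> 0 * int q \<le> p * cf_den \<alpha> 0"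
  proof (rule ccontr)
    assume "\<not> ?thesis"
    then have less: "p < cf_num \<alpha> 0 * int q" by simp
    have "q * (\<alpha> * q - p) < \<alpha> - cf_num \<alpha> 0"
      using best_lower_approx3_beats[OF best, of 1 "cf_num \<alpha> 0"] q less
      by (simp add: cf_term_def)
    moreover have "1 * (\<alpha> * q - p) \<le> q * (\<alpha> * q - p)" using q lt by (intro mult_right_mono) auto
    moreover have "real_of_int p < real_of_int (cf_num \<alpha> 0 * int q)" using less by (simp only: of_int_less_iff)
    moreover have "1 * (\<alpha> - cf_num \<alpha> 0) \<le> q * (\<alpha> - cf_num \<alpha> 0)"
      using q by (intro mult_right_mono) (auto simp: cf_term_def)
    ultimately show False by (simp add: algebra_simps)
  qed
  show ?thesis
  proof (rule convergent_or_beaten[of \<alpha> 0 "int q" p])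
    fix n assume n: "even n = even (0::nat)" "cf_index \<alpha> n" "p * cf_den \<alpha> n \<noteq> cf_num \<alpha> n * int q"
      "cf_den \<alpha> n \<le> int q"
      "cf_den \<alpha> n * ((-1) ^ n * (\<alpha> * cf_den \<alpha> n - cf_num \<alpha> n))
        \<le> real_of_int (int q) * ((-1) ^ n * (\<alpha> * real_of_int (int q) - p))"
    then show ?thesis
      using best_lower_approx3_beats[OF best, of "cf_den \<alpha> n" "cf_num \<alpha> n"]
        cf_den_ge[of \<alpha> n] cf_error_sign[of \<alpha> n] by simp
  qed (use q lt after convergentI_cross_mult in \<open>auto simp: cf_index_def\<close>)
qed

text \<open>The search starts at index 1, so the fractions beyond that convergent must be excluded
  first. The competitor there is the ceiling over 1.\<close>

lemma best_upper_approx3_odd_convergent: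
  assumes best: "best_upper_approx3 \<alpha> p q" and neq: "of_int p / real q \<noteq> \<alpha>"
    and neq_ceiling: "of_int p / real q \<noteq> of_int \<lceil>\<alpha>\<rceil>"
  shows "\<exists>n. odd n \<and> is_convergent \<alpha> n (of_int p / real q)"
proof -
  have q: "q > 0" using best by (simp add: best_upper_approx3_def)
  have "0 \<le> of_int p / real q - \<alpha>"
    using best q by (simp add: best_upper_approx3_def zero_le_mult_iff)
  with neq have "\<alpha> < of_int p / real q" by simp
  then have lt: "0 < p - \<alpha> * q" using q by (simp add: field_simps)
  define a where "a = \<lfloor>\<alpha>\<rfloor>"
  have neq_c: "p \<noteq> \<lceil>\<alpha>\<rceil> * int q" using neq_ceiling q by auto
  have c: "q * (p - \<alpha> * q) < \<lceil>\<alpha>\<rceil> - \<alpha>"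
    using best_upper_approx3_beats[OF best, of 1 "\<lceil>\<alpha>\<rceil>"] q neq_c by simp
  have "0 < q * (p - \<alpha> * q)" using lt q by simp
  \<comment> \<open>For integral \<alpha> the error of the ceiling would be 0, yet it exceeds a
    positive number.\<close>
  with c have "\<alpha> \<notin> \<int>" by (auto simp: Ints_def)
  then have ceil: "\<lceil>\<alpha>\<rceil> = a + 1" and idx: "cf_index \<alpha> 1"
    by (auto simp: a_def ceiling_altdef cf_index_def) (metis Ints_of_int)
  define w where "w = \<alpha> - a"
  have w: "0 \<le> w" "w < 1" by (auto simp: w_def a_def) linarith
  have below: "p < (a + 1) * int q"
  proof (rule ccontr)
    assume "\<not> ?thesis"
    then have "real_of_int ((a + 1) * int q) \<le> real_of_int p" by (simp only: of_int_le_iff)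
    then have "q * (1 - w) \<le> p - \<alpha> * q" by (simp add: w_def algebra_simps)
    moreover have "1 * (1 - w) \<le> q * (1 - w)" using q w by (intro mult_right_mono) auto
    moreover have "1 * (p - \<alpha> * q) \<le> q * (p - \<alpha> * q)" using q lt by (intro mult_right_mono) auto
    ultimately show False using c ceil by (simp add: w_def)
  qed
  have after: "p * cf_den \<alpha> 1 \<le> cf_num \<alpha> 1 * int q"
  proof (rule ccontr)
    assume "\<not> ?thesis"
    then have far: "cf_num \<alpha> 1 * int q < p * cf_den \<alpha> 1" by simp
    define b where "b = cf_term \<alpha> 1"
    \<comment> \<open>Coordinates of \<open>(p, q)\<close> in the basis \<open>(a + 1, 1)\<close>,
      \<open>(a, 1)\<close>, whose errors are \<open>1 - w\<close> and \<open>w\<close>. The first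
      vector is the sum of those of indices -1 and 0.\<close>
    define s t where st: "s = p - a * int q" "t = int q - s"
    have t: "0 < t" using below by (simp add: st algebra_simps)
    have err: "p - \<alpha> * q = s * (1 - w) - t * w"
      by (simp add: st w_def algebra_simps)
    have "real_of_int s = (p - \<alpha> * q) + q * w" by (simp add: st w_def algebra_simps)
    moreover have "0 \<le> q * w" using w by simp
    ultimately have "0 < real_of_int s" using lt by linarith
    then have s: "1 \<le> s" by simp
    have "int q < b * s" using far by (simp add: b_def a_def st cf_term_def algebra_simps)
    then have "int q + 1 \<le> b * s" by simp
    then have "real_of_int (int q + 1) \<le> real_of_int (b * s)" by (simp only: of_int_le_iff)
    then have "real_of_int (int q + 1) * w \<le> real_of_int (b * s) * w"
      using w by (intro mult_right_mono)
    moreover have "b * w \<le> 1"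
      using cf_error_sign[OF idx] by (simp add: b_def w_def a_def cf_term_def algebra_simps)
    then have "s * (b * w) \<le> real_of_int s * 1" using s by (intro mult_left_mono) auto
    \<comment> \<open>Since \<open>s + t = q\<close>, the right side is \<open>s - q * w\<close>,
      and \<open>(q + 1) * w \<le> b * s * w \<le> s\<close>.\<close>
    ultimately have "w \<le> s * (1 - w) - t * w" by (simp add: st algebra_simps)
    then have "1 * (1 - w) \<le> (real_of_int s * 1 + real_of_int t * 1) * (s * (1 - w) - t * w)"
      using s t w by (intro lattice_combination_bound) auto
    then have "1 - w \<le> q * (p - \<alpha> * q)" by (simp add: err) (simp add: st)
    then show False using c ceil by (simp add: w_def)
  qed
  show ?thesis
  proof (rule convergent_or_beaten[of \<alpha> 1 "int q" p])
    fix n assume n: "even n = even (1::nat)" "cf_index \<alpha> n" "p * cf_den \<alpha> n \<noteq> cf_num \<alpha> n * int q"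
      "cf_den \<alpha> n \<le> int q"
      "cf_den \<alpha> n * ((-1) ^ n * (\<alpha> * cf_den \<alpha> n - cf_num \<alpha> n))
        \<le> real_of_int (int q) * ((-1) ^ n * (\<alpha> * real_of_int (int q) - p))"
    then show ?thesis
      using best_upper_approx3_beats[OF best, of "cf_den \<alpha> n" "cf_num \<alpha> n"]
        cf_den_ge[of \<alpha> n] cf_error_sign[of \<alpha> n] by simp
  qed (use q lt after idx convergentI_cross_mult in \<open>auto\<close>)
qed

text \<open>A rational \<alpha> is a best approximation to itself from both sides, with error 0, but
  it equals only its last convergent, whose index has one fixed parity. Hence the alternatives with
  \<open>of_int p / real q = \<alpha>\<close>.\<close>

theorem theorem4:
  fixes \<alpha> :: real
  shows "(\<forall>(p::int) (q::nat). best_lower_approx3 \<alpha> p q \<longrightarrow>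
            (\<exists>n. even n \<and> is_convergent \<alpha> n (of_int p / real q)) \<or>
            (of_int p / real q = \<alpha> \<and> (\<exists>n. odd n \<and> is_convergent \<alpha> n (of_int p / real q)))) \<and>
         (\<forall>(p::int) (q::nat). best_upper_approx3 \<alpha> p q \<longrightarrow>
            of_int p / real q = real_of_int \<lceil>\<alpha>\<rceil> / 1 \<or>
            (\<exists>n. odd n \<and> is_convergent \<alpha> n (of_int p / real q)) \<or>
            (of_int p / real q = \<alpha> \<and> (\<exists>n. even n \<and> is_convergent \<alpha> n (of_int p / real q))))"
proof (intro conjI allI impI)
  fix p :: int and q :: nat
  assume best: "best_lower_approx3 \<alpha> p q"
  show "(\<exists>n. even n \<and> is_convergent \<alpha> n (of_int p / real q)) \<or>
    (of_int p / real q = \<alpha> \<and> (\<exists>n. odd n \<and> is_convergent \<alpha> n (of_int p / real q)))"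
  proof (cases "of_int p / real q = \<alpha>")
    case True
    then have "\<alpha> = of_int p / of_int (int q)" by simp
    then obtain n where "is_convergent \<alpha> n \<alpha>" by (rule value_is_convergent)
    then show ?thesis unfolding True by blast
  next
    case False
    then show ?thesis using best_lower_approx3_even_convergent[OF best] by blast
  qed
next
  fix p :: int and q :: nat
  assume best: "best_upper_approx3 \<alpha> p q"
  show "of_int p / real q = real_of_int \<lceil>\<alpha>\<rceil> / 1 \<or>
    (\<exists>n. odd n \<and> is_convergent \<alpha> n (of_int p / real q)) \<or>
    (of_int p / real q = \<alpha> \<and> (\<exists>n. even n \<and> is_convergent \<alpha> n (of_int p / real q)))"
  proof (cases "of_int p / real q = \<alpha>")
    case True
    then have "\<alpha> = of_int p / of_int (int q)" by simp
    then obtain n where "is_convergent \<alpha> n \<alpha>" by (rule value_is_convergent)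
    then show ?thesis unfolding True by blast
  next
    case False
    then show ?thesis using best_upper_approx3_odd_convergent[OF best False] unfolding div_by_1 by blast
  qed
qed

end
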